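(* Consider the system $s_{t+1}=f(s_t,a_t)$, $a_t=\mu_\theta(s_t)+\varepsilon_t$, $\varepsilon_t\sim\mathcal N(0,\Sigma)$, for $0\le t\le T-1$, as described in the context. Its REINFORCE estimators are $$\widehat G_\theta(\tau):=R(\tau)\sum_{t=0}^{T-1}J_\theta(s_t)^\top\Sigma^{-1}\varepsilon_t,\qquad \widehat G_\ell(\tau):=R(\tau)\sum_{t=0}^{T-1}\big(\Sigma^{-1}(\varepsilon_t\odot\varepsilon_t)-\mathbf 1\big).$$ Assume $\mathbb E[R(\tau)^4\mid s_0]<\infty$ and $\mathbb E[\|J_\theta(s_t)\|_{\mathrm F}^4\mid s_0]<\infty$ for all $t$ and all $s_0$. Then: (i) (Mean-parameter gradient) $$\mathbb E\big[\|\widehat G_\theta(\tau)\|_2^2\mid s_0\big]\le T\,\|\Sigma^{-1}\|_2^2\,\sqrt{\mathbb E[R(\tau)^4\mid s_0]}\,\sqrt{(\mathrm{tr}\,\Sigma)^2+2\,\mathrm{tr}(\Sigma^2)}\,\sum_{t=0}^{T-1}\sqrt{\mathbb E\big[\|J_\theta(s_t)\|_{\mathrm F}^4\mid s_0\big]}.$$ (ii) (Log-std gradient) There is a constant $C$, depending only on the system (and not on $s_0$), such that $$\mathbb E\big[\|\widehat G_\ell(\tau)\|_2^2\mid s_0\big]\le C\,\sqrt{\mathbb E[R(\tau)^4\mid s_0]}.$$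
   Context: $f:\mathbb R^n\times\mathbb R^m\to\mathbb R^n$ is a general (deterministic, measurable) nonlinear map; $\mu_\theta:\mathbb R^n\to\mathbb R^m$ is the policy mean, differentiable in the parameter vector $\theta$, and $J_\theta(s)$ denotes the Jacobian of $\mu_\theta(s)$ with respect to $\theta$ (with $m$ rows). $\Sigma=\mathrm{diag}(e^{2\ell_1},\dots,e^{2\ell_m})\succ0$ with $\ell\in\mathbb R^m$. The noises $\varepsilon_0,\dots,\varepsilon_{T-1}$ are i.i.d. $\mathcal N(0,\Sigma)$ and independent of the initial state $s_0\sim\rho_0$. The return is $R(\tau)=\sum_{t=0}^{T-1}\gamma^tr(s_{t+1},a_t)$, with $r$ the reward function and $\gamma$ the discount factor. $\|\cdot\|_2$ is the Euclidean norm for vectors and the spectral norm for matrices, $\|\cdot\|_{\mathrm F}$ the Frobenius norm, $\odot$ the Hadamard product, $\mathbf 1$ the all-ones vector. *)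

theory Defs
  imports "HOL-Probability.Probability"
begin

definition frobenius_norm :: "real^'p^'m \<Rightarrow> real" where
  "frobenius_norm A = sqrt (\<Sum>i\<in>UNIV. \<Sum>j\<in>UNIV. (A $ i $ j)\<^sup>2)"

text \<open>
  The library norm of a matrix (a vector of vectors) is the Frobenius norm; the spectral norm is the
  operator norm induced by the Euclidean norms.
\<close>
definition spectral_norm :: "real^'p^'m \<Rightarrow> real" where
  "spectral_norm A = onorm (\<lambda>x. A *v x)"

definition noise_cov :: "real^'m \<Rightarrow> real^'m^'m" where
  "noise_cov l = (\<chi> i j. if i = j then exp (2 * l $ i) else 0)"

definition mvn_density :: "real^'m^'m \<Rightarrow> real^'m \<Rightarrow> real" where
  "mvn_density \<Sigma> x =
     exp (- (x \<bullet> (matrix_inv \<Sigma> *v x)) / 2) / sqrt ((2 * pi) ^ CARD('m) * det \<Sigma>)"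

text \<open>
  A trajectory is determined by its initial state \<open>x\<close> and its noise sequence \<open>e\<close>, of which only the
  entries \<open>e 0, \<dots>, e (T - 1)\<close> matter. Here \<open>\<pi>\<close> is the mean of the policy at a fixed parameter.
\<close>

primrec state :: "('s \<times> 'a \<Rightarrow> 's) \<Rightarrow> ('s \<Rightarrow> 'a::plus) \<Rightarrow> 's \<Rightarrow> (nat \<Rightarrow> 'a) \<Rightarrow> nat \<Rightarrow> 's" where
  "state f \<pi> x e 0 = x"
| "state f \<pi> x e (Suc t) = f (state f \<pi> x e t, \<pi> (state f \<pi> x e t) + e t)"

definition action :: "('s \<times> 'a \<Rightarrow> 's) \<Rightarrow> ('s \<Rightarrow> 'a::plus) \<Rightarrow> 's \<Rightarrow> (nat \<Rightarrow> 'a) \<Rightarrow> nat \<Rightarrow> 'a" where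
  "action f \<pi> x e t = \<pi> (state f \<pi> x e t) + e t"

definition total_return ::
  "('s \<times> 'a \<Rightarrow> 's) \<Rightarrow> ('s \<Rightarrow> 'a::plus) \<Rightarrow> ('s \<times> 'a \<Rightarrow> real) \<Rightarrow> real \<Rightarrow> nat \<Rightarrow> 's \<Rightarrow> (nat \<Rightarrow> 'a) \<Rightarrow> real"
where
  "total_return f \<pi> r \<gamma> T x e = (\<Sum>t<T. \<gamma> ^ t * r (state f \<pi> x e (Suc t), action f \<pi> x e t))"

definition policy_jacobian :: "(real^'p \<Rightarrow> 's \<Rightarrow> real^'m) \<Rightarrow> real^'p \<Rightarrow> 's \<Rightarrow> real^'p^'m" where
  "policy_jacobian \<mu> \<theta> s = jacobian (\<lambda>\<eta>. \<mu> \<eta> s) (at \<theta>)"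

definition grad_est_mean ::
  "('s \<times> (real^'m) \<Rightarrow> 's) \<Rightarrow> (real^'p \<Rightarrow> 's \<Rightarrow> real^'m) \<Rightarrow> real^'p \<Rightarrow> real^'m \<Rightarrow>
   ('s \<times> (real^'m) \<Rightarrow> real) \<Rightarrow> real \<Rightarrow> nat \<Rightarrow> 's \<Rightarrow> (nat \<Rightarrow> real^'m) \<Rightarrow> real^'p"
where
  "grad_est_mean f \<mu> \<theta> l r \<gamma> T x e =
     total_return f (\<mu> \<theta>) r \<gamma> T x e *\<^sub>R
       (\<Sum>t<T. transpose (policy_jacobian \<mu> \<theta> (state f (\<mu> \<theta>) x e t)) *v
                (matrix_inv (noise_cov l) *v e t))"

text \<open>Multiplication of vectors is componentwise and its unit is the all-ones vector.\<close>
definition grad_est_logstd ::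
  "('s \<times> (real^'m) \<Rightarrow> 's) \<Rightarrow> (real^'p \<Rightarrow> 's \<Rightarrow> real^'m) \<Rightarrow> real^'p \<Rightarrow> real^'m \<Rightarrow>
   ('s \<times> (real^'m) \<Rightarrow> real) \<Rightarrow> real \<Rightarrow> nat \<Rightarrow> 's \<Rightarrow> (nat \<Rightarrow> real^'m) \<Rightarrow> real^'m"
where
  "grad_est_logstd f \<mu> \<theta> l r \<gamma> T x e =
     total_return f (\<mu> \<theta>) r \<gamma> T x e *\<^sub>R
       (\<Sum>t<T. matrix_inv (noise_cov l) *v (e t * e t) - 1)"

text \<open>
  The initial state has law \<open>\<rho>\<close>, the noises are i.i.d. centred Gaussian, and the noises jointly are
  independent of the initial state. The last condition is phrased with the generated sigma-algebras
  because \<^const>\<open>prob_space.indep_var\<close> only relates random variables of the same type.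
\<close>

definition rollout_space ::
  "'w measure \<Rightarrow> (real^'n) measure \<Rightarrow> real^'m \<Rightarrow> nat \<Rightarrow> ('w \<Rightarrow> real^'n) \<Rightarrow> (nat \<Rightarrow> 'w \<Rightarrow> real^'m) \<Rightarrow> bool"
where
  "rollout_space M \<rho> l T s0 \<epsilon> \<longleftrightarrow>
     prob_space M \<and>
     s0 \<in> borel_measurable M \<and> distr M borel s0 = \<rho> \<and>
     (\<forall>t<T. distributed M lborel (\<epsilon> t) (\<lambda>x. ennreal (mvn_density (noise_cov l) x))) \<and>
     prob_space.indep_vars M (\<lambda>_. borel) \<epsilon> {..<T} \<and>
     prob_space.indep_set M
       (sets (vimage_algebra (space M) s0 borel))
       (sets (vimage_algebra (space M) (\<lambda>\<omega>. \<lambda>t\<in>{..<T}. \<epsilon> t \<omega>) (\<Pi>\<^sub>M t\<in>{..<T}. borel)))"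

text \<open>
  Conditional expectation given \<open>s0\<close> of a nonnegative random variable \<open>X\<close>. It takes values in the
  extended nonnegative reals, so that finiteness is a genuine assertion: \<^const>\<open>real_cond_exp\<close>
  would return 0 instead of infinity.
\<close>

definition cond_exp_given ::
  "'w measure \<Rightarrow> ('w \<Rightarrow> 's::topological_space) \<Rightarrow> ('w \<Rightarrow> real) \<Rightarrow> 'w \<Rightarrow> ennreal"
where
  "cond_exp_given M s0 X = nn_cond_exp M (vimage_algebra (space M) s0 borel) (\<lambda>\<omega>. ennreal (X \<omega>))"

end

theory Submission
  imports Defs
begin

text \<open>
  Because the noise is independent of the initial state, conditioning on \<open>s\<^sub>0\<close> amounts to freezing the
  initial state and integrating over the law of the noise. For a frozen initial state, the squared
  norm of an estimator \<open>R \<Sum>\<^sub>t v\<^sub>t\<close> is at most \<open>T \<Sum>\<^sub>t R\<^sup>2 \<parallel>v\<^sub>t\<parallel>\<^sup>2\<close>, and Cauchy--Schwarz separates \<open>R\<close> from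
  \<open>v\<^sub>t\<close>. In the mean-parameter case the state at time \<open>t\<close> depends only on the noise before \<open>t\<close>, so
  that the fourth moment of \<open>v\<^sub>t\<close> factors into those of the Jacobian and of the Gaussian noise; the
  latter is \<open>(tr \<Sigma>)\<^sup>2 + 2 tr (\<Sigma>\<^sup>2)\<close>. In the log-std case \<open>v\<^sub>t\<close> is a function of the noise at time \<open>t\<close> alone.
\<close>

subsection \<open>Moments of the Gaussian noise\<close>

lemma noise_cov_mult_vec: "noise_cov l *v x = (\<chi> i. exp (2 * l $ i) * x $ i)"
  unfolding noise_cov_def matrix_vector_mult_def
  by (simp add: vec_eq_iff if_distrib[of "\<lambda>a. a * b" for b] cong: if_cong)

text \<open>Negating the log standard deviations inverts every diagonal entry. From here on,
  Sigma^{-1} is handled through its explicit diagonal action.\<close>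

lemma matrix_inv_noise_cov: "matrix_inv (noise_cov l) = noise_cov (- l)"
proof -
  have inv: "noise_cov (- a) ** noise_cov a = mat 1" for a :: "real^'m"
    by (simp add: matrix_eq matrix_vector_mul_assoc[symmetric] noise_cov_mult_vec vec_eq_iff
        mult.assoc[symmetric] exp_add[symmetric])
  then have inv': "noise_cov l ** noise_cov (- l) = mat 1"
    using inv[of "- l"] by simp
  show ?thesis
    unfolding matrix_inv_def
  proof (rule some_equality)
    show "noise_cov l ** noise_cov (- l) = mat 1 \<and> noise_cov (- l) ** noise_cov l = mat 1"
      using inv inv' by blast
  next
    \<comment> \<open>\<open>matrix_inv\<close> is a Hilbert choice, so a two-sided inverse
      identifies it only together with uniqueness.\<close>
    fix B assume "noise_cov l ** B = mat 1 \<and> B ** noise_cov l = mat 1"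
    then show "B = noise_cov (- l)"
      using inv' by (metis matrix_mul_assoc matrix_mul_lid matrix_mul_rid)
  qed
qed

lemma det_noise_cov: "det (noise_cov l) = (\<Prod>i\<in>UNIV. exp (2 * l $ i))"
  by (subst det_diagonal) (auto simp: noise_cov_def)

lemma trace_noise_cov: "trace (noise_cov l) = (\<Sum>i\<in>UNIV. exp (2 * l $ i))"
  by (simp add: trace_def noise_cov_def)

lemma trace_noise_cov_sq:
  "trace (noise_cov l ** noise_cov l) = (\<Sum>i\<in>UNIV. (exp (2 * l $ i))\<^sup>2)"
  by (simp add: trace_def noise_cov_def matrix_matrix_mult_def power2_eq_square
      if_distrib[of "\<lambda>a. a * b" for b] cong: if_cong)

text \<open>For a diagonal covariance the quadratic form is a sum and the determinant a product over
  coordinates, so the density splits into one-dimensional normal densities with standard deviations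
  exp(l_i). This reduces all later Gaussian integrals to dimension one.\<close>

lemma mvn_density_noise_cov:
  "mvn_density (noise_cov l) x = (\<Prod>i\<in>UNIV. normal_density 0 (exp (l $ i)) (x $ i))"
proof -
  have "- (x \<bullet> (noise_cov (- l) *v x)) / 2 = (\<Sum>i\<in>UNIV. - (x $ i)\<^sup>2 / (2 * (exp (l $ i))\<^sup>2))"
    by (simp add: noise_cov_mult_vec inner_vec_def sum_negf[symmetric] sum_divide_distrib
        power2_eq_square exp_minus exp_add[symmetric] field_simps)
  moreover have "sqrt ((2 * pi) ^ CARD('a) * (\<Prod>i\<in>UNIV. exp (2 * l $ i)))
      = (\<Prod>i\<in>UNIV. sqrt (2 * pi * (exp (l $ i))\<^sup>2))"
  proof (rule real_sqrt_unique)
    show "(\<Prod>i\<in>UNIV. sqrt (2 * pi * (exp (l $ i))\<^sup>2))\<^sup>2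
        = (2 * pi) ^ CARD('a) * (\<Prod>i\<in>UNIV. exp (2 * l $ i))"
      unfolding prod_power_distrib by (simp add: prod.distrib exp_double power_mult_distrib)
  qed (simp add: prod_nonneg)
  ultimately show ?thesis
    unfolding mvn_density_def matrix_inv_noise_cov det_noise_cov normal_density_def
    by (simp add: exp_sum prod_dividef prod.distrib)
qed

section \<open>The Gaussian noise law and its product integrals\<close>

definition gaussian_noise :: "real^'m \<Rightarrow> (real^'m) measure" where
  "gaussian_noise l = density lborel (\<lambda>x. ennreal (mvn_density (noise_cov l) x))"

lemma measurable_mvn_density_noise_cov[measurable]:
  "mvn_density (noise_cov l) \<in> borel_measurable borel"
  unfolding mvn_density_noise_cov[abs_def] by measurable

lemma sets_gaussian_noise[simp, measurable_cong]: "sets (gaussian_noise l) = sets borel"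
  by (simp add: gaussian_noise_def)

lemma space_gaussian_noise[simp]: "space (gaussian_noise l) = UNIV"
  by (simp add: gaussian_noise_def)

text \<open>Lebesgue measure factors over \<open>Basis\<close>, the Gaussian density over coordinate
  indices; this translates between the two index sets.\<close>

lemma prod_Basis_vec:
  fixes F :: "real^'m \<Rightarrow> 'b::comm_monoid_mult"
  shows "(\<Prod>b\<in>Basis. F b) = (\<Prod>i\<in>UNIV. F (axis i 1))"
proof -
  have Basis: "(Basis :: (real^'m) set) = range (\<lambda>i. axis i 1)"
    by (auto simp: Basis_vec_def)
  have "inj (\<lambda>i::'m. axis i (1::real))"
    by (simp add: inj_def axis_eq_axis)
  then show ?thesis
    unfolding Basis by (subst prod.reindex) auto
qed

text \<open>Independence of the coordinates in integral form: density and integrand are both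
  products over coordinates, so Tonelli splits the integral.\<close>

lemma nn_integral_gaussian_noise_prod:
  fixes l :: "real^'m" and g :: "'m \<Rightarrow> real \<Rightarrow> ennreal"
  assumes [measurable]: "\<And>i. g i \<in> borel_measurable borel"
  shows "(\<integral>\<^sup>+x. (\<Prod>i\<in>UNIV. g i (x $ i)) \<partial>gaussian_noise l)
    = (\<Prod>i\<in>UNIV. \<integral>\<^sup>+y. ennreal (normal_density 0 (exp (l $ i)) y) * g i y \<partial>lborel)"
proof -
  \<comment> \<open>\<open>axis_index\<close> recovers the coordinate from its basis vector, so that
    \<open>G\<close> can be indexed by \<open>Basis\<close>.\<close>
  define G where "G b y = ennreal (normal_density 0 (exp (l $ axis_index b)) y) * g (axis_index b) y"
    for b :: "real^'m" and y
  have "(\<integral>\<^sup>+x. (\<Prod>i\<in>UNIV. g i (x $ i)) \<partial>gaussian_noise l)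
    = (\<integral>\<^sup>+x. (\<Prod>i\<in>UNIV. ennreal (normal_density 0 (exp (l $ i)) (x $ i)) * g i (x $ i)) \<partial>lborel)"
    unfolding gaussian_noise_def
    by (subst nn_integral_density)
      (auto simp: mvn_density_noise_cov prod.distrib prod_ennreal intro!: nn_integral_cong)
  also have "\<dots> = (\<integral>\<^sup>+x. (\<Prod>b\<in>Basis. G b (x \<bullet> b)) \<partial>lborel)"
    by (simp add: prod_Basis_vec G_def inner_axis)
  also have "\<dots> = (\<Prod>b\<in>Basis. \<integral>\<^sup>+y. G b y \<partial>lborel)"
    by (rule nn_integral_lborel_prod) (auto simp: G_def)
  finally show ?thesis
    by (simp add: prod_Basis_vec G_def)
qed

text \<open>Used with k = 0 (normalisation), k = 1 (variance), k = 2 (fourth moment) and k = 4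
  (finiteness of the eighth moment).\<close>

lemma nn_integral_normal_moment_even:
  assumes "0 < \<sigma>"
  shows "(\<integral>\<^sup>+y. ennreal (normal_density 0 \<sigma> y) * ennreal (y ^ (2 * k)) \<partial>lborel)
    = ennreal (fact (2 * k) / ((2 / \<sigma>\<^sup>2) ^ k * fact k))"
proof -
  have "(\<integral>\<^sup>+y. ennreal (normal_density 0 \<sigma> y) * ennreal (y ^ (2 * k)) \<partial>lborel)
    = (\<integral>\<^sup>+y. ennreal (normal_density 0 \<sigma> y * y ^ (2 * k)) \<partial>lborel)"
    by (simp add: ennreal_mult'')
  also have "\<dots> = ennreal (fact (2 * k) / ((2 / \<sigma>\<^sup>2) ^ k * fact k))"
    using normal_moment_even[of \<sigma> 0 k] assms
    by (subst nn_integral_eq_integral) (auto simp: has_bochner_integral_iff)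
  finally show ?thesis .
qed

text \<open>Marginalisation: all coordinates other than i carry the constant function 1 and
  integrate to 1.\<close>

lemma nn_integral_gaussian_noise_component:
  fixes l :: "real^'m" and h :: "real \<Rightarrow> ennreal"
  assumes [measurable]: "h \<in> borel_measurable borel"
  shows "(\<integral>\<^sup>+x. h (x $ i) \<partial>gaussian_noise l)
    = (\<integral>\<^sup>+y. ennreal (normal_density 0 (exp (l $ i)) y) * h y \<partial>lborel)"
proof -
  define g where "g k = (if k = i then h else (\<lambda>_. 1))" for k
  have "g k \<in> borel_measurable borel" for k
    by (simp add: g_def)
  note * = nn_integral_gaussian_noise_prod[of g l, OF this]
  have 1: "(\<Prod>k\<in>UNIV. g k (x $ k)) = h (x $ i)" for x :: "real^'m"
    by (subst prod.remove[of _ i]) (auto simp: g_def)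
  have "(\<integral>\<^sup>+y. ennreal (normal_density 0 (exp (l $ k)) y) * g k y \<partial>lborel) = 1" if "k \<noteq> i" for k
    using nn_integral_normal_moment_even[of "exp (l $ k)" 0] that by (simp add: g_def)
  then have 2: "(\<Prod>k\<in>UNIV. \<integral>\<^sup>+y. ennreal (normal_density 0 (exp (l $ k)) y) * g k y \<partial>lborel)
     = (\<integral>\<^sup>+y. ennreal (normal_density 0 (exp (l $ i)) y) * h y \<partial>lborel)"
    by (subst prod.remove[of _ i]) (auto simp: g_def)
  show ?thesis
    using * unfolding 1 2 .
qed

lemma prob_space_gaussian_noise: "prob_space (gaussian_noise l)"
  using nn_integral_gaussian_noise_prod[of "\<lambda>_ _. 1" l]
    nn_integral_normal_moment_even[of "exp (l $ i)" 0 for i]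
  by (auto intro!: prob_spaceI)

lemma nn_integral_gaussian_noise_sq_mult_sq:
  fixes l :: "real^'m"
  shows "(\<integral>\<^sup>+x. ennreal ((x $ i)\<^sup>2 * (x $ j)\<^sup>2) \<partial>gaussian_noise l)
    = ennreal ((if i = j then 3 else 1) * (exp (2 * l $ i) * exp (2 * l $ j)))"
proof (cases "i = j")
  case True
  have "(\<integral>\<^sup>+x. ennreal ((x $ i)\<^sup>2 * (x $ i)\<^sup>2) \<partial>gaussian_noise l)
    = (\<integral>\<^sup>+x. ennreal ((x $ i) ^ (2 * 2)) \<partial>gaussian_noise l)"
    by (simp add: power_add[symmetric])
  \<comment> \<open>The factor 3 is 4! / (2^2 * 2!) from the moment formula with k = 2.\<close>
  also have "\<dots> = ennreal (3 * (exp (2 * l $ i) * exp (2 * l $ i)))"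
    using nn_integral_normal_moment_even[of "exp (l $ i)" 2]
    by (subst nn_integral_gaussian_noise_component[where h = "\<lambda>y. ennreal (y ^ (2 * 2))"])
      (auto simp: fact_numeral power_divide exp_double power_mult_distrib power2_eq_square)
  finally show ?thesis
    using True by simp
next
  case False
  \<comment> \<open>Squares sit at the two distinct coordinates i and j. The exponent is written
    \<open>2 * 1\<close> to match the even-moment formula.\<close>
  define g where "g k y = (if k = i \<or> k = j then ennreal (y ^ (2 * 1)) else 1)" for k :: 'm and y :: real
  have "g k \<in> borel_measurable borel" for k
    unfolding g_def by measurable
  note * = nn_integral_gaussian_noise_prod[of g l, OF this]
  have prod2: "(\<Prod>k\<in>UNIV. F k) = F i * F j" if "\<And>k. k \<noteq> i \<Longrightarrow> k \<noteq> j \<Longrightarrow> F k = 1" for F :: "'m \<Rightarrow> ennreal"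
  proof -
    have "(\<Prod>k\<in>UNIV. F k) = (\<Prod>k\<in>{i, j}. F k)"
      by (rule prod.mono_neutral_right) (auto simp: that)
    then show ?thesis using False by simp
  qed
  have 1: "(\<Prod>k\<in>UNIV. g k (x $ k)) = ennreal ((x $ i)\<^sup>2 * (x $ j)\<^sup>2)" for x
    by (subst prod2) (auto simp: g_def ennreal_mult'')
  have m0: "(\<integral>\<^sup>+y. ennreal (normal_density 0 (exp (l $ k)) y) * g k y \<partial>lborel) = 1"
    if "k \<noteq> i" "k \<noteq> j" for k
    using nn_integral_normal_moment_even[of "exp (l $ k)" 0] that by (simp add: g_def)
  have m1: "(\<integral>\<^sup>+y. ennreal (normal_density 0 (exp (l $ k)) y) * g k y \<partial>lborel) = ennreal (exp (2 * l $ k))"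
    if "k = i \<or> k = j" for k
    using nn_integral_normal_moment_even[of "exp (l $ k)" 1] that
    by (auto simp add: g_def exp_double)
  show ?thesis
    using * unfolding 1 by (subst (asm) prod2) (auto simp: m0 m1 False ennreal_mult'')
qed

text \<open>Expanding the fourth power of the norm gives a double sum of products of squared
  coordinates. If all pairs behaved as independent, the result would be (tr Sigma)^2; each diagonal
  pair has moment 3 instead of 1 times the squared variance, and this excess is 2
  tr(Sigma^2).\<close>

lemma nn_integral_gaussian_noise_norm4:
  "(\<integral>\<^sup>+x. ennreal (norm x ^ 4) \<partial>gaussian_noise l)
    = ennreal ((trace (noise_cov l))\<^sup>2 + 2 * trace (noise_cov l ** noise_cov l))"
proof -
  have norm4: "norm x ^ 4 = (\<Sum>i\<in>UNIV. \<Sum>j\<in>UNIV. (x $ i)\<^sup>2 * (x $ j)\<^sup>2)" for x :: "real^'a"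
  proof -
    have "norm x ^ 4 = ((norm x)\<^sup>2)\<^sup>2"
      by (simp add: power_mult[symmetric])
    also have "(norm x)\<^sup>2 = (\<Sum>i\<in>UNIV. (x $ i)\<^sup>2)"
      by (simp add: norm_vec_def L2_set_def sum_nonneg)
    finally show ?thesis
      by (simp add: power2_eq_square[of "sum _ _"] sum_product)
  qed
  have "(\<integral>\<^sup>+x. ennreal (norm x ^ 4) \<partial>gaussian_noise l)
     = (\<Sum>i\<in>UNIV. \<Sum>j\<in>UNIV. \<integral>\<^sup>+x. ennreal ((x $ i)\<^sup>2 * (x $ j)\<^sup>2) \<partial>gaussian_noise l)"
    unfolding norm4 by (simp add: nn_integral_sum sum_ennreal[symmetric] sum_nonneg del: sum_ennreal)
  also have "\<dots> = ennreal (\<Sum>i\<in>UNIV. \<Sum>j\<in>UNIV. (if i = j then 3 else 1) * (exp (2 * l $ i) * exp (2 * l $ j)))"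
    by (simp add: nn_integral_gaussian_noise_sq_mult_sq sum_nonneg)
  also have "(\<Sum>i\<in>UNIV. \<Sum>j\<in>UNIV. (if i = j then 3 else 1) * (exp (2 * l $ i) * exp (2 * l $ j)))
    = (\<Sum>i\<in>UNIV. \<Sum>j\<in>UNIV. exp (2 * l $ i) * exp (2 * l $ j)
        + (if i = j then 2 * (exp (2 * l $ i))\<^sup>2 else 0))"
    by (intro sum.cong) (auto simp: power2_eq_square)
  also have "\<dots> = (trace (noise_cov l))\<^sup>2 + 2 * trace (noise_cov l ** noise_cov l)"
    by (simp add: sum.distrib trace_noise_cov trace_noise_cov_sq sum_distrib_left[symmetric]
        sum_distrib_right[symmetric] power2_eq_square[of "sum _ _"])
  finally show ?thesis .
qed

text \<open>Only finiteness matters for the constant in (ii), so the norm is bounded crudely by a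
  polynomial in even powers of the coordinates, all of whose moments are finite.\<close>

lemma nn_integral_gaussian_noise_score4_finite:
  fixes l :: "real^'m"
  shows "(\<integral>\<^sup>+x. ennreal (norm (matrix_inv (noise_cov l) *v (x * x) - 1) ^ 4) \<partial>gaussian_noise l) < \<infinity>"
proof -
  define a where "a i = exp (2 * (- l) $ i)" for i
  \<comment> \<open>The additive constant 8 is kept as \<open>8 * (x $ i) ^ (2 * 0)\<close>, so that
    both terms are even powers covered by \<open>mom\<close>. The factor \<open>CARD('m)\<close>
    comes from Cauchy--Schwarz on the squared norm.\<close>
  have bound: "norm (matrix_inv (noise_cov l) *v (x * x) - 1) ^ 4
      \<le> real CARD('m) * (\<Sum>i\<in>UNIV. 8 * a i ^ 4 * (x $ i) ^ (2 * 4) + 8 * (x $ i) ^ (2 * 0))" for x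
  proof -
    let ?v = "matrix_inv (noise_cov l) *v (x * x) - 1"
    have v: "?v $ i = a i * (x $ i)\<^sup>2 - 1" for i
      by (simp add: matrix_inv_noise_cov noise_cov_mult_vec a_def power2_eq_square)
    have "norm ?v ^ 4 = ((norm ?v)\<^sup>2)\<^sup>2"
      by (simp add: power_mult[symmetric])
    also have "(norm ?v)\<^sup>2 = (\<Sum>i\<in>UNIV. (?v $ i)\<^sup>2)"
      by (simp add: norm_vec_def L2_set_def sum_nonneg)
    also have "\<dots>\<^sup>2 \<le> (\<Sum>i\<in>UNIV. ((?v $ i)\<^sup>2)\<^sup>2) * CARD('m)"
      by (rule sum_squared_le_sum_of_squares)
    also have "\<dots> \<le> (\<Sum>i\<in>UNIV. 8 * a i ^ 4 * (x $ i) ^ (2 * 4) + 8 * (x $ i) ^ (2 * 0)) * CARD('m)"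
    proof (intro mult_right_mono sum_mono)
      fix i
      have "(b - 1)\<^sup>2 \<le> 2 * b\<^sup>2 + 2" for b :: real
        using sum_squares_bound[of b "-1"] by (simp add: power2_diff)
      then have "((b - 1)\<^sup>2)\<^sup>2 \<le> (2 * b\<^sup>2 + 2)\<^sup>2" for b :: real
        by (intro power_mono) auto
      moreover have "(2 * b\<^sup>2 + 2)\<^sup>2 \<le> 8 * b ^ 4 + 8" for b :: real
        using sum_squares_bound[of "b\<^sup>2" 1] by (simp add: power2_sum power_mult_distrib power_mult[symmetric])
      ultimately have "((b - 1)\<^sup>2)\<^sup>2 \<le> 8 * b ^ 4 + 8" for b :: real
        by (meson order.trans)
      from this[of "a i * (x $ i)\<^sup>2"]
      show "((?v $ i)\<^sup>2)\<^sup>2 \<le> 8 * a i ^ 4 * (x $ i) ^ (2 * 4) + 8 * (x $ i) ^ (2 * 0)"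
        unfolding v by (simp add: power_mult_distrib power_mult[symmetric] mult.assoc)
    qed simp
    finally show ?thesis
      by (simp add: mult.commute)
  qed
  have mom: "(\<integral>\<^sup>+x. ennreal ((x $ i) ^ (2 * k)) \<partial>gaussian_noise l) < \<infinity>" for i k
    by (subst nn_integral_gaussian_noise_component[where h = "\<lambda>y. ennreal (y ^ (2 * k))"])
      (auto simp: nn_integral_normal_moment_even)
  have "(\<integral>\<^sup>+x. ennreal (norm (matrix_inv (noise_cov l) *v (x * x) - 1) ^ 4) \<partial>gaussian_noise l)
     \<le> (\<integral>\<^sup>+x. ennreal (real CARD('m)) * (\<Sum>i\<in>UNIV. ennreal (8 * a i ^ 4) * ennreal ((x $ i) ^ (2 * 4))
            + 8 * ennreal ((x $ i) ^ (2 * 0))) \<partial>gaussian_noise l)"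
    by (intro nn_integral_mono order.trans[OF ennreal_leI[OF bound]])
      (simp add: ennreal_mult ennreal_plus sum_nonneg sum_ennreal[symmetric] del: sum_ennreal)
  also have "\<dots> < \<infinity>"
    using mom[of _ 4] mom[of _ 0] by (simp add: nn_integral_cmult nn_integral_sum nn_integral_add
        ennreal_mult_less_top ennreal_mult_eq_top_iff less_top[symmetric])
  finally show ?thesis .
qed

subsection \<open>Norms and measurability\<close>

lemma borel_measurable_vecI:
  fixes f :: "'w \<Rightarrow> real^'m"
  assumes "\<And>i. (\<lambda>x. f x $ i) \<in> borel_measurable M"
  shows "f \<in> borel_measurable M"
  by (subst borel_measurable_euclidean_space) (auto simp: Basis_vec_def inner_axis assms)

lemma borel_measurable_vec_nth[measurable (raw)]:
  fixes f :: "'w \<Rightarrow> real^'m"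
  assumes "f \<in> borel_measurable M"
  shows "(\<lambda>x. f x $ i) \<in> borel_measurable M"
  using assms by (simp add: cart_eq_inner_axis)

lemma matrix_vector_mult_measurable:
  fixes A :: "'w \<Rightarrow> real^'p^'m"
  assumes [measurable]: "\<And>i j. (\<lambda>x. A x $ i $ j) \<in> borel_measurable M" "v \<in> borel_measurable M"
  shows "(\<lambda>x. A x *v v x) \<in> borel_measurable M"
  by (rule borel_measurable_vecI) (simp add: matrix_vector_mult_def)

text \<open>An entry of the Jacobian is a partial derivative in the parameter, hence a pointwise
  limit of difference quotients. Each quotient is measurable in the state because the policy mean is
  measurable for every fixed parameter.\<close>

lemma policy_jacobian_component_measurable:
  fixes \<mu> :: "real^'p \<Rightarrow> real^'n \<Rightarrow> real^'m"
  assumes [measurable]: "\<And>\<eta>. \<mu> \<eta> \<in> borel_measurable borel"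
    and diff: "\<And>s. (\<lambda>\<eta>. \<mu> \<eta> s) differentiable (at \<theta>)"
  shows "(\<lambda>s. policy_jacobian \<mu> \<theta> s $ i $ j) \<in> borel_measurable borel"
proof (rule borel_measurable_LIMSEQ_real)
  define h where "h n = inverse (real (Suc n))" for n
  show "(\<lambda>s. (\<mu> (\<theta> + h n *\<^sub>R axis j 1) s $ i - \<mu> \<theta> s $ i) / h n) \<in> borel_measurable borel" for n
    by simp
  fix s
  have "((\<lambda>\<eta>. \<mu> \<eta> s) has_derivative (\<lambda>v. policy_jacobian \<mu> \<theta> s *v v)) (at \<theta>)"
    using diff[of s] unfolding policy_jacobian_def jacobian_works .
  then have D: "((\<lambda>\<eta>. \<mu> \<eta> s $ i) has_derivative (\<lambda>v. (policy_jacobian \<mu> \<theta> s *v v) $ i))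
      (at (\<theta> + 0 *\<^sub>R axis j 1))"
    by (auto intro: bounded_linear.has_derivative[OF bounded_linear_vec_nth])
  have "((\<lambda>t::real. \<theta> + t *\<^sub>R axis j 1) has_derivative (\<lambda>t. t *\<^sub>R axis j 1)) (at 0)"
    by (auto intro!: derivative_eq_intros)
  from has_derivative_compose[OF this, where g = "\<lambda>\<eta>. \<mu> \<eta> s $ i", OF D]
  have "((\<lambda>t::real. \<mu> (\<theta> + t *\<^sub>R axis j 1) s $ i) has_derivative
      (\<lambda>t. (policy_jacobian \<mu> \<theta> s *v (t *\<^sub>R axis j 1)) $ i)) (at 0)" .
  then have "((\<lambda>t::real. \<mu> (\<theta> + t *\<^sub>R axis j 1) s $ i) has_field_derivative
      policy_jacobian \<mu> \<theta> s $ i $ j) (at 0)"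
    unfolding has_field_derivative_def
    by (rule has_derivative_eq_rhs)
      (simp add: fun_eq_iff matrix_vector_mult_scaleR matrix_vector_mult_basis column_def mult.commute)
  then have lim: "((\<lambda>t::real. (\<mu> (\<theta> + t *\<^sub>R axis j 1) s $ i - \<mu> \<theta> s $ i) / t)
      \<longlongrightarrow> policy_jacobian \<mu> \<theta> s $ i $ j) (at 0)"
    by (simp add: DERIV_def)
  \<comment> \<open>The steps 1/(n+1) never vanish, so they converge in the punctured neighbourhood
    filter used by the derivative.\<close>
  have "filterlim h (at 0) sequentially"
    unfolding filterlim_at h_def using LIMSEQ_inverse_real_of_nat by auto
  from filterlim_compose[OF lim this]
  show "(\<lambda>n. (\<mu> (\<theta> + h n *\<^sub>R axis j 1) s $ i - \<mu> \<theta> s $ i) / h n) \<longlonglongrightarrow> policy_jacobian \<mu> \<theta> s $ i $ j" .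
qed

lemma frobenius_norm_nonneg[simp]: "0 \<le> frobenius_norm A"
  by (simp add: frobenius_norm_def sum_nonneg)

lemma frobenius_norm_measurable:
  assumes [measurable]: "\<And>i j. (\<lambda>x. A x $ i $ j) \<in> borel_measurable M"
  shows "(\<lambda>x. frobenius_norm (A x)) \<in> borel_measurable M"
  unfolding frobenius_norm_def by measurable

text \<open>Entry j of the product pairs column j of A with v. Cauchy--Schwarz in each column and
  summation over the columns give the Frobenius norm.\<close>

lemma norm_transpose_mult_le:
  fixes A :: "real^'p^'m"
  shows "norm (transpose A *v v) \<le> frobenius_norm A * norm v"
proof (rule power2_le_imp_le)
  have "(norm (transpose A *v v))\<^sup>2 = (\<Sum>j\<in>UNIV. (\<Sum>i\<in>UNIV. A $ i $ j * v $ i)\<^sup>2)"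
    by (simp add: norm_vec_def L2_set_def sum_nonneg matrix_vector_mult_def transpose_def)
  also have "\<dots> \<le> (\<Sum>j\<in>UNIV. (\<Sum>i\<in>UNIV. (A $ i $ j)\<^sup>2) * (\<Sum>i\<in>UNIV. (v $ i)\<^sup>2))"
    by (intro sum_mono Cauchy_Schwarz_ineq_sum)
  also have "\<dots> = (\<Sum>i\<in>UNIV. \<Sum>j\<in>UNIV. (A $ i $ j)\<^sup>2) * (\<Sum>i\<in>UNIV. (v $ i)\<^sup>2)"
    by (subst sum.swap) (simp add: sum_distrib_right)
  also have "\<dots> = (frobenius_norm A * norm v)\<^sup>2"
    by (simp add: power_mult_distrib frobenius_norm_def norm_vec_def L2_set_def sum_nonneg)
  finally show "(norm (transpose A *v v))\<^sup>2 \<le> (frobenius_norm A * norm v)\<^sup>2" .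
qed simp

lemma norm_matrix_mult_le: "norm (A *v x) \<le> spectral_norm A * norm x"
  unfolding spectral_norm_def by (rule onorm) simp

lemma spectral_norm_nonneg: "0 \<le> spectral_norm A"
  unfolding spectral_norm_def by (rule onorm_pos_le) simp

text \<open>Causality of the dynamics. It makes the Jacobian at time t independent of the noise at
  time t, and it allows the noise sequence to be cut off at the horizon.\<close>

lemma state_cong:
  assumes "\<And>k. k < t \<Longrightarrow> e k = e' k"
  shows "state f \<pi> x e t = state f \<pi> x e' t"
  using assms by (induction t) auto

lemma total_return_cong:
  assumes "\<And>k. k < T \<Longrightarrow> e k = e' k"
  shows "total_return f \<pi> r \<gamma> T x e = total_return f \<pi> r \<gamma> T x e'"
  unfolding total_return_def action_def
proof (intro sum.cong refl, goal_cases)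
  case (1 t)
  then have "state f \<pi> x e t = state f \<pi> x e' t" "state f \<pi> x e (Suc t) = state f \<pi> x e' (Suc t)"
    by (auto intro!: state_cong assms simp del: state.simps)
  with 1 show ?case by (simp add: assms)
qed

text \<open>Joint measurability in initial state and noise is what Tonelli requires when the initial
  state is frozen. Time t reads only noise coordinates below t, which lie in the index set because t
  is at most T.\<close>

lemma state_measurable:
  fixes f :: "(real^'n) \<times> (real^'m) \<Rightarrow> real^'n"
  assumes [measurable]: "f \<in> borel_measurable borel" "\<pi> \<in> borel_measurable borel"
    and "t \<le> T"
  shows "(\<lambda>p. state f \<pi> (fst p) (snd p) t) \<in> borel_measurable (borel \<Otimes>\<^sub>M PiM {..<T} (\<lambda>_. borel))"
  using \<open>t \<le> T\<close>
proof (induction t)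
  case (Suc t)
  then have [measurable]: "(\<lambda>p. state f \<pi> (fst p) (snd p) t) \<in> borel_measurable (borel \<Otimes>\<^sub>M PiM {..<T} (\<lambda>_. borel))"
    "t \<in> {..<T}"
    by auto
  show ?case by simp
qed simp

lemma total_return_measurable:
  fixes f :: "(real^'n) \<times> (real^'m) \<Rightarrow> real^'n"
  assumes [measurable]: "f \<in> borel_measurable borel" "\<pi> \<in> borel_measurable borel" "r \<in> borel_measurable borel"
  shows "(\<lambda>p. total_return f \<pi> r \<gamma> T (fst p) (snd p)) \<in> borel_measurable (borel \<Otimes>\<^sub>M PiM {..<T} (\<lambda>_. borel))"
  unfolding total_return_def action_def
proof (intro borel_measurable_sum borel_measurable_times borel_measurable_const)
  fix t assume t: "t \<in> {..<T}"
  note [measurable] = state_measurable[of f \<pi> t T] state_measurable[of f \<pi> "Suc t" T] t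
  show "(\<lambda>p. r (state f \<pi> (fst p) (snd p) (Suc t), \<pi> (state f \<pi> (fst p) (snd p) t) + snd p t))
      \<in> borel_measurable (borel \<Otimes>\<^sub>M PiM {..<T} (\<lambda>_. borel))"
    using t by (simp del: state.simps)
qed

subsection \<open>Independence, conditioning and Cauchy--Schwarz\<close>

lemma nn_integral_mult_le_sqrt:
  assumes [measurable]: "u \<in> borel_measurable M" "v \<in> borel_measurable M"
    and nonneg: "\<And>x. 0 \<le> u x" "\<And>x. 0 \<le> v x" "0 \<le> a" "0 \<le> b"
    and u: "(\<integral>\<^sup>+x. ennreal ((u x)\<^sup>2) \<partial>M) \<le> ennreal a"
    and v: "(\<integral>\<^sup>+x. ennreal ((v x)\<^sup>2) \<partial>M) \<le> ennreal b"
  shows "(\<integral>\<^sup>+x. ennreal (u x * v x) \<partial>M) \<le> ennreal (sqrt a * sqrt b)"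
proof -
  define I where "I = (\<integral>\<^sup>+x. ennreal (u x * v x) \<partial>M)"
  have "I\<^sup>2 \<le> (\<integral>\<^sup>+x. ennreal ((u x)\<^sup>2) \<partial>M) * (\<integral>\<^sup>+x. ennreal ((v x)\<^sup>2) \<partial>M)"
    using Cauchy_Schwarz_nn_integral[of "\<lambda>x. ennreal (u x)" M "\<lambda>x. ennreal (v x)"] nonneg
    by (simp add: I_def ennreal_mult ennreal_power)
  also have "\<dots> \<le> ennreal a * ennreal b"
    by (rule mult_mono[OF u v]) auto
  finally have I: "I\<^sup>2 \<le> ennreal (a * b)"
    using nonneg by (simp add: ennreal_mult)
  show ?thesis
  \<comment> \<open>A priori the integral may be infinite; the finite bound on its square excludes
    this.\<close>
  proof (cases I)
    case (real i)
    with I nonneg have "i\<^sup>2 \<le> a * b"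
      by (simp add: ennreal_power)
    then have "i \<le> sqrt a * sqrt b"
      by (simp add: real_le_rsqrt real_sqrt_mult[symmetric])
    then show ?thesis
      using real by (simp add: I_def ennreal_leI)
  next
    case top
    then show ?thesis
      using I by (simp add: top_unique)
  qed
qed

text \<open>Triangle inequality followed by Cauchy--Schwarz against the constant 1. With I the set
  of time steps, this is the source of the factor T.\<close>

lemma norm_sum_sq_le:
  "(norm (\<Sum>i\<in>I. v i))\<^sup>2 \<le> card I * (\<Sum>i\<in>I. (norm (v i))\<^sup>2)"
proof -
  have "(norm (\<Sum>i\<in>I. v i))\<^sup>2 \<le> (\<Sum>i\<in>I. norm (v i))\<^sup>2"
    by (intro power_mono norm_sum) simp
  also have "\<dots> \<le> (\<Sum>i\<in>I. (norm (v i))\<^sup>2) * card I"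
    by (rule sum_squared_le_sum_of_squares)
  finally show ?thesis
    by (simp add: mult.commute)
qed

text \<open>The estimate shared by both estimators. The return and the scores are functions of the
  same noise, so their moments cannot simply be multiplied; Cauchy--Schwarz separates them at the
  cost of fourth moments.\<close>

lemma nn_integral_norm_scaleR_sum_sq_le:
  fixes v :: "nat \<Rightarrow> 'w \<Rightarrow> 'b::euclidean_space"
  assumes [measurable]: "R \<in> borel_measurable M" "\<And>t. t < T \<Longrightarrow> v t \<in> borel_measurable M"
    and fin: "(\<integral>\<^sup>+x. ennreal (R x ^ 4) \<partial>M) < \<infinity>"
    and v: "\<And>t. t < T \<Longrightarrow> (\<integral>\<^sup>+x. ennreal (norm (v t x) ^ 4) \<partial>M) \<le> ennreal (b t)"
    and b: "\<And>t. t < T \<Longrightarrow> 0 \<le> b t"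
  shows "(\<integral>\<^sup>+x. ennreal ((norm (R x *\<^sub>R (\<Sum>t<T. v t x)))\<^sup>2) \<partial>M)
    \<le> ennreal (real T * sqrt (enn2real (\<integral>\<^sup>+x. ennreal (R x ^ 4) \<partial>M)) * (\<Sum>t<T. sqrt (b t)))"
proof -
  define A where "A = enn2real (\<integral>\<^sup>+x. ennreal (R x ^ 4) \<partial>M)"
  have A: "(\<integral>\<^sup>+x. ennreal (R x ^ 4) \<partial>M) = ennreal A" "0 \<le> A"
    using fin by (auto simp: A_def)
  have bound: "(norm (R x *\<^sub>R (\<Sum>t<T. v t x)))\<^sup>2 \<le> real T * (\<Sum>t<T. (R x)\<^sup>2 * (norm (v t x))\<^sup>2)" for x
    using mult_left_mono[OF norm_sum_sq_le[of "\<lambda>t. v t x" "{..<T}"], of "(R x)\<^sup>2"]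
    by (simp add: power_mult_distrib sum_distrib_left mult.left_commute)
  have "(\<integral>\<^sup>+x. ennreal ((norm (R x *\<^sub>R (\<Sum>t<T. v t x)))\<^sup>2) \<partial>M)
    \<le> (\<integral>\<^sup>+x. ennreal (real T) * (\<Sum>t<T. ennreal ((R x)\<^sup>2 * (norm (v t x))\<^sup>2)) \<partial>M)"
    by (intro nn_integral_mono order.trans[OF ennreal_leI[OF bound]])
      (simp add: ennreal_mult[of "real T"] sum_nonneg)
  also have "\<dots> = ennreal (real T) * (\<Sum>t<T. \<integral>\<^sup>+x. ennreal ((R x)\<^sup>2 * (norm (v t x))\<^sup>2) \<partial>M)"
    using nn_integral_sum[of "{..<T}" "\<lambda>t x. ennreal ((R x)\<^sup>2 * (norm (v t x))\<^sup>2)" M]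
    by (subst nn_integral_cmult) (auto simp del: sum_ennreal)
  \<comment> \<open>Cauchy--Schwarz is applied to the squares of \<open>R\<close> and of the norm of
    \<open>v t\<close>, whose own squares are the fourth powers in the hypotheses.\<close>
  also have "\<dots> \<le> ennreal (real T) * (\<Sum>t<T. ennreal (sqrt A * sqrt (b t)))"
    using A v b
    by (intro mult_left_mono sum_mono nn_integral_mult_le_sqrt) (auto simp: power_mult[symmetric])
  also have "\<dots> = ennreal (real T * sqrt A * (\<Sum>t<T. sqrt (b t)))"
    using A b
    by (subst sum_ennreal)
      (auto simp: ennreal_mult'[symmetric] sum_distrib_left[symmetric] mult.assoc)
  finally show ?thesis
    by (simp add: A_def)
qed

text \<open>Since \<open>g\<close> ignores coordinate i, it is independent of any function of that
  coordinate. Integrating coordinate i separately from the rest makes this a product of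
  integrals.\<close>

lemma (in product_prob_space) nn_integral_PiM_mult_component:
  assumes "finite I" "i \<in> I"
    and g[measurable]: "g \<in> borel_measurable (PiM I M)" and h[measurable]: "h \<in> borel_measurable (M i)"
    and inv: "\<And>x y. g (x(i := y)) = g x"
  shows "(\<integral>\<^sup>+x. g x * h (x i) \<partial>PiM I M) = (\<integral>\<^sup>+x. g x \<partial>PiM I M) * (\<integral>\<^sup>+y. h y \<partial>M i)"
proof -
  let ?J = "I - {i}"
  have I: "insert i ?J = I" and fin: "finite ?J" "i \<notin> ?J"
    using assms by auto
  obtain c where c: "c \<in> space (M i)"
    using M.not_empty[of i] by blast
  \<comment> \<open>Filling coordinate i with a fixed point embeds the smaller product into the
    larger one, and \<open>g\<close> does not notice; this transfers its measurability.\<close>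
  have "(\<lambda>x. x(i := c)) \<in> measurable (PiM ?J M) (PiM I M)"
    using I c by (intro measurable_fun_upd[of _ ?J]) auto
  from measurable_compose[OF this g] have gJ: "g \<in> borel_measurable (PiM ?J M)"
    by (simp add: inv)
  have fub: "(\<integral>\<^sup>+x. g x * k (x i) \<partial>PiM I M) = (\<integral>\<^sup>+x. g x \<partial>PiM ?J M) * (\<integral>\<^sup>+y. k y \<partial>M i)"
    if k[measurable]: "k \<in> borel_measurable (M i)" for k
  proof -
    have "(\<lambda>x. g x * k (x i)) \<in> borel_measurable (PiM I M)"
      using \<open>i \<in> I\<close> by measurable
    then have "(\<integral>\<^sup>+x. g x * k (x i) \<partial>PiM I M) = (\<integral>\<^sup>+x. (\<integral>\<^sup>+y. g x * k y \<partial>M i) \<partial>PiM ?J M)"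
      using product_nn_integral_insert[OF fin, of "\<lambda>x. g x * k (x i)"] unfolding I by (simp add: inv)
    also have "\<dots> = (\<integral>\<^sup>+x. g x \<partial>PiM ?J M) * (\<integral>\<^sup>+y. k y \<partial>M i)"
      using gJ by (simp add: nn_integral_cmult nn_integral_multc)
    finally show ?thesis .
  qed
  \<comment> \<open>The instance with the constant 1 identifies the integral of \<open>g\<close>
    over the smaller product with that over the full one.\<close>
  show ?thesis
    using fub[OF h] fub[of "\<lambda>_. 1"] by (simp add: M.emeasure_space_1)
qed

text \<open>The freezing principle: when the joint law is a product, conditioning on X fixes the
  first argument and integrates over the law of the second. The candidate is a function of X, hence
  measurable for the generated sigma-algebra, so it remains to compare integrals over the sets of
  that sigma-algebra.\<close>

lemma nn_cond_exp_vimage_algebra_pair: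
  assumes "prob_space M" "sigma_finite_measure N"
    and X[measurable]: "X \<in> measurable M S" and Y[measurable]: "Y \<in> measurable M N"
    and joint: "distr M (S \<Otimes>\<^sub>M N) (\<lambda>\<omega>. (X \<omega>, Y \<omega>)) = distr M S X \<Otimes>\<^sub>M N"
    and h[measurable]: "h \<in> borel_measurable (S \<Otimes>\<^sub>M N)"
  shows "AE \<omega> in M. nn_cond_exp M (vimage_algebra (space M) X S) (\<lambda>\<omega>. h (X \<omega>, Y \<omega>)) \<omega>
    = (\<integral>\<^sup>+y. h (X \<omega>, y) \<partial>N)"
proof -
  interpret prob_space M by fact
  interpret N: sigma_finite_measure N by fact
  let ?F = "vimage_algebra (space M) X S"
  have XF: "X \<in> measurable ?F S"
    by (rule measurable_vimage_algebra1) (auto intro: measurable_space[OF X])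
  have sub: "subalgebra M ?F"
    unfolding subalgebra_def by (simp add: sets_image_in_sets' measurable_sets[OF X])
  interpret finite_measure_subalgebra M ?F
    by standard (rule sub)
  define k where "k x = (\<integral>\<^sup>+y. h (x, y) \<partial>N)" for x
  have k[measurable]: "k \<in> borel_measurable S"
    unfolding k_def by (rule N.borel_measurable_nn_integral_fst[OF h])
  have "AE \<omega> in M. k (X \<omega>) = nn_cond_exp M ?F (\<lambda>\<omega>. h (X \<omega>, Y \<omega>)) \<omega>"
  proof (rule nn_cond_exp_charact)
    show "(\<lambda>\<omega>. h (X \<omega>, Y \<omega>)) \<in> borel_measurable M"
      by measurable
    show "(\<lambda>\<omega>. k (X \<omega>)) \<in> borel_measurable ?F"
      using measurable_compose[OF XF k] .
    fix A assume "A \<in> sets ?F"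
    \<comment> \<open>Every conditioning set is a preimage under X, so its indicator is a function
      of X and can be pulled out of the inner integral.\<close>
    then obtain B where B[measurable]: "B \<in> sets S" and A: "A = X -` B \<inter> space M"
      by (subst (asm) sets_vimage_algebra2) (auto intro: measurable_space[OF X])
    have "(\<integral>\<^sup>+\<omega>\<in>A. h (X \<omega>, Y \<omega>) \<partial>M) = (\<integral>\<^sup>+\<omega>. h (X \<omega>, Y \<omega>) * indicator B (X \<omega>) \<partial>M)"
      by (intro nn_integral_cong) (auto simp: A indicator_def)
    also have "\<dots> = (\<integral>\<^sup>+p. h p * indicator B (fst p) \<partial>distr M (S \<Otimes>\<^sub>M N) (\<lambda>\<omega>. (X \<omega>, Y \<omega>)))"
      by (subst nn_integral_distr) auto
    also have "\<dots> = (\<integral>\<^sup>+x. \<integral>\<^sup>+y. h (x, y) * indicator B x \<partial>N \<partial>distr M S X)"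
      unfolding joint by (subst N.nn_integral_fst[symmetric]) auto
    also have "\<dots> = (\<integral>\<^sup>+x. k x * indicator B x \<partial>distr M S X)"
      by (intro nn_integral_cong) (auto simp: k_def nn_integral_multc)
    also have "\<dots> = (\<integral>\<^sup>+\<omega>. k (X \<omega>) * indicator B (X \<omega>) \<partial>M)"
      by (subst nn_integral_distr) auto
    also have "\<dots> = (\<integral>\<^sup>+\<omega>\<in>A. k (X \<omega>) \<partial>M)"
      by (intro nn_integral_cong) (auto simp: A indicator_def)
    finally show "(\<integral>\<^sup>+\<omega>\<in>A. h (X \<omega>, Y \<omega>) \<partial>M) = (\<integral>\<^sup>+\<omega>\<in>A. k (X \<omega>) \<partial>M)" .
  qed
  then show ?thesis
    by eventually_elim (simp add: k_def)
qed

text \<open>Independence gives the product formula on measurable rectangles, and these determine the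
  product measure.\<close>

lemma (in prob_space) distr_pair_indep_vimage_algebra:
  assumes X[measurable]: "X \<in> measurable M S" and Y[measurable]: "Y \<in> measurable M N"
    and indep: "indep_set (sets (vimage_algebra (space M) X S)) (sets (vimage_algebra (space M) Y N))"
  shows "distr M (S \<Otimes>\<^sub>M N) (\<lambda>\<omega>. (X \<omega>, Y \<omega>)) = distr M S X \<Otimes>\<^sub>M distr M N Y"
proof (rule sym, rule pair_measure_eqI)
  show "sigma_finite_measure (distr M S X)" "sigma_finite_measure (distr M N Y)"
    using X Y by (auto intro!: prob_space_imp_sigma_finite prob_space_distr)
  fix A B assume "A \<in> sets (distr M S X)" "B \<in> sets (distr M N Y)"
  then have [measurable]: "A \<in> sets S" "B \<in> sets N" by auto
  have "X -` A \<inter> space M \<in> sets (vimage_algebra (space M) X S)"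
    "Y -` B \<inter> space M \<in> sets (vimage_algebra (space M) Y N)"
    by (auto intro: in_vimage_algebra)
  from indep_setD[OF indep this]
  have "prob ((X -` A \<inter> space M) \<inter> (Y -` B \<inter> space M))
    = prob (X -` A \<inter> space M) * prob (Y -` B \<inter> space M)" .
  moreover have "(\<lambda>\<omega>. (X \<omega>, Y \<omega>)) -` (A \<times> B) \<inter> space M = (X -` A \<inter> space M) \<inter> (Y -` B \<inter> space M)"
    by auto
  ultimately show "emeasure (distr M S X) A * emeasure (distr M N Y) B
      = emeasure (distr M (S \<Otimes>\<^sub>M N) (\<lambda>\<omega>. (X \<omega>, Y \<omega>))) (A \<times> B)"
    by (simp add: emeasure_distr emeasure_eq_measure ennreal_mult)
qed (simp cong: sets_pair_measure_cong)

subsection \<open>Rollouts\<close>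

text \<open>Points of this space are noise sequences that are \<open>undefined\<close> from index T
  on, which is why raw noise sequences are restricted before being compared with it.\<close>

definition noise_law :: "real^'m \<Rightarrow> nat \<Rightarrow> (nat \<Rightarrow> real^'m) measure" where
  "noise_law l T = PiM {..<T} (\<lambda>_. gaussian_noise l)"

lemma sets_noise_law[measurable_cong]:
  "sets (noise_law l T) = sets (PiM {..<T} (\<lambda>_. borel))"
  unfolding noise_law_def by (rule sets_PiM_cong) auto

lemma prob_space_noise_law: "prob_space (noise_law l T)"
  unfolding noise_law_def by (rule prob_space_PiM prob_space_gaussian_noise)+

lemma nn_integral_noise_law_component:
  assumes "t < T" and [measurable]: "h \<in> borel_measurable borel"
  shows "(\<integral>\<^sup>+e. h (e t) \<partial>noise_law l T) = (\<integral>\<^sup>+x. h x \<partial>gaussian_noise l)"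
proof -
  have "(\<integral>\<^sup>+x. h x \<partial>gaussian_noise l) =
      (\<integral>\<^sup>+x. h x \<partial>distr (PiM {..<T} (\<lambda>_. gaussian_noise l)) (gaussian_noise l) (\<lambda>e. e t))"
    using assms by (subst distr_PiM_component) (auto intro: prob_space_gaussian_noise)
  also have "\<dots> = (\<integral>\<^sup>+e. h (e t) \<partial>noise_law l T)"
    unfolding noise_law_def using assms by (subst nn_integral_distr) auto
  finally show ?thesis ..
qed

lemma nn_integral_noise_law_mult_component:
  assumes "t < T" and [measurable]: "g \<in> borel_measurable (noise_law l T)" "h \<in> borel_measurable borel"
    and inv: "\<And>e y. g (e(t := y)) = g e"
  shows "(\<integral>\<^sup>+e. g e * h (e t) \<partial>noise_law l T)
    = (\<integral>\<^sup>+e. g e \<partial>noise_law l T) * (\<integral>\<^sup>+x. h x \<partial>gaussian_noise l)"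
proof -
  interpret product_prob_space "\<lambda>_. gaussian_noise l" "{..<T}"
    by (rule product_prob_spaceI) (rule prob_space_gaussian_noise)
  show ?thesis
    using assms nn_integral_PiM_mult_component[of t g h] by (simp add: noise_law_def)
qed

lemma rollout_noise_law:
  assumes "rollout_space M \<rho> l T s0 \<epsilon>"
  shows "distr M (\<Pi>\<^sub>M t\<in>{..<T}. borel) (\<lambda>\<omega>. \<lambda>t\<in>{..<T}. \<epsilon> t \<omega>) = noise_law l T"
proof -
  interpret prob_space M
    using assms by (simp add: rollout_space_def)
  have indep: "indep_vars (\<lambda>_. borel) \<epsilon> {..<T}"
    and dist: "\<And>t. t < T \<Longrightarrow> distributed M lborel (\<epsilon> t) (\<lambda>x. ennreal (mvn_density (noise_cov l) x))"
    using assms by (auto simp: rollout_space_def)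
  have rv: "\<And>t. t \<in> {..<T} \<Longrightarrow> \<epsilon> t \<in> borel_measurable M"
    using indep by (auto simp: indep_vars_def2)
  have law: "distr M borel (\<epsilon> t) = gaussian_noise l" if "t < T" for t
  proof -
    have "distr M borel (\<epsilon> t) = distr M lborel (\<epsilon> t)"
      by (rule distr_cong) auto
    then show ?thesis
      using distributed_distr_eq_density[OF dist[OF that]] by (simp add: gaussian_noise_def)
  qed
  show ?thesis
  \<comment> \<open>The characterisation of independence by product laws is applied to a nonempty
    index set. For T = 0 both sides are the point mass at the everywhere undefined sequence.\<close>
  proof (cases "T = 0")
    case True
    interpret product_prob_space "\<lambda>_::nat. gaussian_noise l"
      by (rule product_prob_spaceI) (rule prob_space_gaussian_noise)
    show ?thesis
      unfolding noise_law_def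
      by (rule PiM_eqI)
        (auto simp: True PiM_empty emeasure_distr emeasure_space_1 restrict_def)
  next
    case False
    then have "distr M (\<Pi>\<^sub>M t\<in>{..<T}. borel) (\<lambda>\<omega>. \<lambda>t\<in>{..<T}. \<epsilon> t \<omega>) = (\<Pi>\<^sub>M t\<in>{..<T}. distr M borel (\<epsilon> t))"
      using indep rv by (subst (asm) indep_vars_iff_distr_eq_PiM') auto
    also have "\<dots> = noise_law l T"
      unfolding noise_law_def by (rule PiM_cong) (auto simp: law)
    finally show ?thesis .
  qed
qed

text \<open>The bridge from conditional expectations to integrals over the noise law. The hypothesis
  \<open>cong\<close> reconciles the full sequence used by the rollout with its restriction below T,
  on which the noise law lives.\<close>

lemma cond_exp_given_rollout:
  fixes h :: "real^'n \<Rightarrow> (nat \<Rightarrow> real^'m) \<Rightarrow> real"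
  assumes ro: "rollout_space M \<rho> l T s0 \<epsilon>"
    and h: "(\<lambda>p. h (fst p) (snd p)) \<in> borel_measurable (borel \<Otimes>\<^sub>M PiM {..<T} (\<lambda>_. borel))"
    and cong: "\<And>s e e'. (\<And>t. t < T \<Longrightarrow> e t = e' t) \<Longrightarrow> h s e = h s e'"
  shows "AE \<omega> in M. cond_exp_given M s0 (\<lambda>\<omega>. h (s0 \<omega>) (\<lambda>t. \<epsilon> t \<omega>)) \<omega>
    = (\<integral>\<^sup>+e. ennreal (h (s0 \<omega>) e) \<partial>noise_law l T)"
proof -
  interpret prob_space M
    using ro by (simp add: rollout_space_def)
  let ?P = "PiM {..<T} (\<lambda>_. borel) :: (nat \<Rightarrow> real^'m) measure"
  let ?Y = "\<lambda>\<omega>. \<lambda>t\<in>{..<T}. \<epsilon> t \<omega>"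
  have rv: "\<And>t. t < T \<Longrightarrow> \<epsilon> t \<in> borel_measurable M" and s0: "s0 \<in> borel_measurable M"
    and indep: "indep_set (sets (vimage_algebra (space M) s0 borel))
       (sets (vimage_algebra (space M) ?Y ?P))"
    using ro by (auto simp: rollout_space_def indep_vars_def2)
  have Y: "?Y \<in> measurable M ?P"
    using rv by (intro measurable_restrict) auto
  have N: "borel \<Otimes>\<^sub>M noise_law l T \<rightarrow>\<^sub>M borel = borel \<Otimes>\<^sub>M ?P \<rightarrow>\<^sub>M (borel :: ennreal measure)"
    by (rule measurable_cong_sets) (auto intro!: sets_pair_measure_cong sets_noise_law)
  have "distr M (borel \<Otimes>\<^sub>M noise_law l T) (\<lambda>\<omega>. (s0 \<omega>, ?Y \<omega>)) = distr M (borel \<Otimes>\<^sub>M ?P) (\<lambda>\<omega>. (s0 \<omega>, ?Y \<omega>))"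
    by (rule distr_cong) (auto intro!: sets_pair_measure_cong sets_noise_law)
  also have "\<dots> = distr M borel s0 \<Otimes>\<^sub>M noise_law l T"
    using distr_pair_indep_vimage_algebra[OF s0 Y indep] rollout_noise_law[OF ro] by simp
  finally have joint: "distr M (borel \<Otimes>\<^sub>M noise_law l T) (\<lambda>\<omega>. (s0 \<omega>, ?Y \<omega>)) = distr M borel s0 \<Otimes>\<^sub>M noise_law l T" .
  have "?Y \<in> measurable M (noise_law l T)"
    using Y measurable_cong_sets[OF refl sets_noise_law] by blast
  moreover have "(\<lambda>p. ennreal (h (fst p) (snd p))) \<in> borel_measurable (borel \<Otimes>\<^sub>M noise_law l T)"
    unfolding N using h by measurable
  ultimately have "AE \<omega> in M. nn_cond_exp M (vimage_algebra (space M) s0 borel)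
      (\<lambda>\<omega>. ennreal (h (s0 \<omega>) (?Y \<omega>))) \<omega> = (\<integral>\<^sup>+e. ennreal (h (s0 \<omega>) e) \<partial>noise_law l T)"
    using nn_cond_exp_vimage_algebra_pair[OF prob_space_axioms
        prob_space_imp_sigma_finite[OF prob_space_noise_law] s0 _ joint, of "\<lambda>p. ennreal (h (fst p) (snd p))"] by simp
  moreover have "h (s0 \<omega>) (?Y \<omega>) = h (s0 \<omega>) (\<lambda>t. \<epsilon> t \<omega>)" for \<omega>
    by (rule cong) simp
  ultimately show ?thesis
    by (simp add: cond_exp_given_def)
qed

lemma noise_law_section_measurable:
  assumes "(\<lambda>p. h (fst p) (snd p)) \<in> measurable (borel \<Otimes>\<^sub>M PiM {..<T} (\<lambda>_. borel)) L"
  shows "h s \<in> measurable (noise_law l T) L"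
proof -
  have "Pair s \<in> measurable (PiM {..<T} (\<lambda>_. borel)) (borel \<Otimes>\<^sub>M PiM {..<T} (\<lambda>_. borel))"
    by simp
  from measurable_compose[OF this assms] show ?thesis
    by (simp add: measurable_cong_sets[OF sets_noise_law refl])
qed

text \<open>The gradient in the mean parameter of the log-density of the policy at the action taken
  at time t.\<close>

definition score_mean where
  "score_mean f \<mu> \<theta> l t x e = transpose (policy_jacobian \<mu> \<theta> (state f (\<mu> \<theta>) x e t)) *v
                (matrix_inv (noise_cov l) *v e t)"

text \<open>The gradient of the Gaussian log-density in the log standard deviations; it depends on
  the noise alone.\<close>

definition score_logstd :: "real^'m \<Rightarrow> real^'m \<Rightarrow> real^'m" where
  "score_logstd l x = matrix_inv (noise_cov l) *v (x * x) - 1"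

lemma score_logstd_measurable[measurable]: "score_logstd l \<in> borel_measurable borel"
  by (rule borel_measurable_vecI) (simp add: score_logstd_def matrix_inv_noise_cov noise_cov_mult_vec)

lemma jacobian_measurable:
  fixes f :: "(real^'n) \<times> (real^'m) \<Rightarrow> real^'n" and \<mu> :: "real^'p \<Rightarrow> real^'n \<Rightarrow> real^'m"
  assumes "f \<in> borel_measurable borel" "\<And>\<eta>. \<mu> \<eta> \<in> borel_measurable borel"
    and "\<And>s. (\<lambda>\<eta>. \<mu> \<eta> s) differentiable (at \<theta>)" and "t < T"
  shows "(\<lambda>p. policy_jacobian \<mu> \<theta> (state f (\<mu> \<theta>) (fst p) (snd p) t) $ i $ j)
    \<in> borel_measurable (borel \<Otimes>\<^sub>M PiM {..<T} (\<lambda>_. borel))"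
  by (rule measurable_compose[OF state_measurable policy_jacobian_component_measurable])
    (use assms in auto)

lemma score_mean_measurable:
  fixes f :: "(real^'n) \<times> (real^'m) \<Rightarrow> real^'n" and \<mu> :: "real^'p \<Rightarrow> real^'n \<Rightarrow> real^'m"
  assumes "f \<in> borel_measurable borel" "\<And>\<eta>. \<mu> \<eta> \<in> borel_measurable borel"
    and "\<And>s. (\<lambda>\<eta>. \<mu> \<eta> s) differentiable (at \<theta>)" and "t < T"
  shows "(\<lambda>p. score_mean f \<mu> \<theta> l t (fst p) (snd p))
    \<in> borel_measurable (borel \<Otimes>\<^sub>M PiM {..<T} (\<lambda>_. borel))"
  unfolding score_mean_def
proof (intro matrix_vector_mult_measurable)
  show "(\<lambda>p. snd p t) \<in> borel_measurable (borel \<Otimes>\<^sub>M PiM {..<T} (\<lambda>_. borel))"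
    using \<open>t < T\<close> by simp
qed (use jacobian_measurable[OF assms] in \<open>auto simp: transpose_def\<close>)

text \<open>Pointwise the score is at most the Frobenius norm of the Jacobian times the spectral
  norm of Sigma^{-1} times the norm of the current noise. The Jacobian factor is independent of the
  current noise, so the fourth moments multiply.\<close>

lemma nn_integral_score_mean4_le:
  fixes f :: "(real^'n) \<times> (real^'m) \<Rightarrow> real^'n" and \<mu> :: "real^'p \<Rightarrow> real^'n \<Rightarrow> real^'m"
  assumes m: "f \<in> borel_measurable borel" "\<And>\<eta>. \<mu> \<eta> \<in> borel_measurable borel"
      "\<And>s. (\<lambda>\<eta>. \<mu> \<eta> s) differentiable (at \<theta>)" "t < T"
  shows "(\<integral>\<^sup>+e. ennreal (norm (score_mean f \<mu> \<theta> l t s e) ^ 4) \<partial>noise_law l T)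
    \<le> (\<integral>\<^sup>+e. ennreal (frobenius_norm (policy_jacobian \<mu> \<theta> (state f (\<mu> \<theta>) s e t)) ^ 4) \<partial>noise_law l T)
      * ennreal (spectral_norm (matrix_inv (noise_cov l)) ^ 4
          * ((trace (noise_cov l))\<^sup>2 + 2 * trace (noise_cov l ** noise_cov l)))"
proof -
  let ?F = "\<lambda>e. frobenius_norm (policy_jacobian \<mu> \<theta> (state f (\<mu> \<theta>) s e t))"
  let ?S = "spectral_norm (matrix_inv (noise_cov l))"
  have F[measurable]: "?F \<in> borel_measurable (noise_law l T)"
    by (rule noise_law_section_measurable[OF frobenius_norm_measurable])
      (rule jacobian_measurable[OF m])
  \<comment> \<open>The state at time t uses only noise strictly before t, so changing entry t
    leaves the Jacobian unchanged.\<close>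
  have inv: "?F (e(t := y)) = ?F e" for e y
    using state_cong[of t "e(t := y)" e f "\<mu> \<theta>" s] by simp
  have bound: "norm (score_mean f \<mu> \<theta> l t s e) ^ 4 \<le> ?F e ^ 4 * (?S ^ 4 * norm (e t) ^ 4)" for e
  proof -
    have "norm (score_mean f \<mu> \<theta> l t s e) \<le> ?F e * (?S * norm (e t))"
      unfolding score_mean_def
      by (rule order.trans[OF norm_transpose_mult_le])
        (intro mult_left_mono norm_matrix_mult_le frobenius_norm_nonneg)
    from power_mono[OF this, of 4] show ?thesis
      by (simp add: power_mult_distrib)
  qed
  have "(\<integral>\<^sup>+e. ennreal (norm (score_mean f \<mu> \<theta> l t s e) ^ 4) \<partial>noise_law l T)
    \<le> (\<integral>\<^sup>+e. ennreal (?F e ^ 4) * ennreal (?S ^ 4 * norm (e t) ^ 4) \<partial>noise_law l T)"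
    using bound by (intro nn_integral_mono) (simp add: ennreal_mult[symmetric] spectral_norm_nonneg ennreal_leI)
  also have "\<dots> = (\<integral>\<^sup>+e. ennreal (?F e ^ 4) \<partial>noise_law l T) * (\<integral>\<^sup>+x. ennreal (?S ^ 4 * norm x ^ 4) \<partial>gaussian_noise l)"
    by (rule nn_integral_noise_law_mult_component[OF \<open>t < T\<close>]) (auto simp: inv simp del: fun_upd_apply)
  also have "(\<integral>\<^sup>+x. ennreal (?S ^ 4 * norm x ^ 4) \<partial>gaussian_noise l)
      = ennreal (?S ^ 4) * (\<integral>\<^sup>+x. ennreal (norm x ^ 4) \<partial>gaussian_noise l)"
    by (subst nn_integral_cmult[symmetric]) (auto simp: ennreal_mult spectral_norm_nonneg)
  finally show ?thesis
    by (simp add: nn_integral_gaussian_noise_norm4 ennreal_mult'[symmetric] ennreal_mult''[symmetric] spectral_norm_nonneg)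
qed

section \<open>Conditional second moments of the two estimators\<close>

lemma grad_est_mean_eq:
  "grad_est_mean f \<mu> \<theta> l r \<gamma> T x e =
    total_return f (\<mu> \<theta>) r \<gamma> T x e *\<^sub>R (\<Sum>t<T. score_mean f \<mu> \<theta> l t x e)"
  by (simp add: grad_est_mean_def score_mean_def)

lemma grad_est_logstd_eq:
  "grad_est_logstd f \<mu> \<theta> l r \<gamma> T x e =
    total_return f (\<mu> \<theta>) r \<gamma> T x e *\<^sub>R (\<Sum>t<T. score_logstd l (e t))"
  by (simp add: grad_est_logstd_def score_logstd_def)

lemma score_mean_cong:
  assumes "\<And>k. k \<le> t \<Longrightarrow> e k = e' k"
  shows "score_mean f \<mu> \<theta> l t x e = score_mean f \<mu> \<theta> l t x e'"
  using assms state_cong[of t e e' f "\<mu> \<theta>" x] by (simp add: score_mean_def)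

lemma cond_exp_return4:
  fixes f :: "(real^'n) \<times> (real^'m) \<Rightarrow> real^'n"
  assumes "f \<in> borel_measurable borel" "\<pi> \<in> borel_measurable borel" "r \<in> borel_measurable borel"
    and ro: "rollout_space M \<rho> l T s0 \<epsilon>"
  shows "AE \<omega> in M. cond_exp_given M s0 (\<lambda>\<omega>. total_return f \<pi> r \<gamma> T (s0 \<omega>) (\<lambda>t. \<epsilon> t \<omega>) ^ 4) \<omega>
    = (\<integral>\<^sup>+e. ennreal (total_return f \<pi> r \<gamma> T (s0 \<omega>) e ^ 4) \<partial>noise_law l T)"
proof (rule cond_exp_given_rollout[OF ro])
  show "(\<lambda>p. total_return f \<pi> r \<gamma> T (fst p) (snd p) ^ 4)
      \<in> borel_measurable (borel \<Otimes>\<^sub>M PiM {..<T} (\<lambda>_. borel))"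
    by (intro borel_measurable_power total_return_measurable assms)
qed (use total_return_cong in metis)

text \<open>Off a null set all conditional expectations equal integrals with frozen initial state
  and the assumed moments are finite; there the deterministic estimate applies.\<close>

lemma cond_exp_grad_est_mean_le:
  fixes f :: "(real^'n) \<times> (real^'m) \<Rightarrow> real^'n" and \<mu> :: "real^'p \<Rightarrow> real^'n \<Rightarrow> real^'m"
    and \<gamma> :: real
  assumes f: "f \<in> borel_measurable borel" and \<mu>: "\<And>\<eta>. \<mu> \<eta> \<in> borel_measurable borel"
    and diff: "\<And>s. (\<lambda>\<eta>. \<mu> \<eta> s) differentiable (at \<theta>)"
    and r: "r \<in> borel_measurable borel" and ro: "rollout_space M \<rho> l T s0 \<epsilon>"
  defines "R \<equiv> cond_exp_given M s0 (\<lambda>\<omega>. total_return f (\<mu> \<theta>) r \<gamma> T (s0 \<omega>) (\<lambda>t. \<epsilon> t \<omega>) ^ 4)"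
    and "J \<equiv> \<lambda>t. cond_exp_given M s0 (\<lambda>\<omega>. frobenius_norm (policy_jacobian \<mu> \<theta>
              (state f (\<mu> \<theta>) (s0 \<omega>) (\<lambda>t. \<epsilon> t \<omega>) t)) ^ 4)"
  assumes R: "AE \<omega> in M. R \<omega> < \<infinity>" and J: "\<forall>t<T. AE \<omega> in M. J t \<omega> < \<infinity>"
  shows "AE \<omega> in M. cond_exp_given M s0
      (\<lambda>\<omega>. (norm (grad_est_mean f \<mu> \<theta> l r \<gamma> T (s0 \<omega>) (\<lambda>t. \<epsilon> t \<omega>)))\<^sup>2) \<omega>
    \<le> ennreal (real T * (spectral_norm (matrix_inv (noise_cov l)))\<^sup>2 * sqrt (enn2real (R \<omega>))
        * sqrt ((trace (noise_cov l))\<^sup>2 + 2 * trace (noise_cov l ** noise_cov l))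
        * (\<Sum>t<T. sqrt (enn2real (J t \<omega>))))"
proof -
  let ?P = "borel \<Otimes>\<^sub>M PiM {..<T} (\<lambda>_. borel) :: ((real^'n) \<times> (nat \<Rightarrow> real^'m)) measure"
  let ?F = "\<lambda>t s e. frobenius_norm (policy_jacobian \<mu> \<theta> (state f (\<mu> \<theta>) s e t))"
  let ?S = "spectral_norm (matrix_inv (noise_cov l))"
  let ?K = "(trace (noise_cov l))\<^sup>2 + 2 * trace (noise_cov l ** noise_cov l)"
  have K: "0 \<le> ?K"
    by (simp add: trace_noise_cov_sq sum_nonneg)
  note R_meas = total_return_measurable[OF f \<mu> r, of \<theta> \<gamma> T]
  note v_meas = score_mean_measurable[OF f \<mu> diff]
  have J_eq: "AE \<omega> in M. J t \<omega> = (\<integral>\<^sup>+e. ennreal (?F t (s0 \<omega>) e ^ 4) \<partial>noise_law l T)" if "t < T" for t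
    unfolding J_def
  proof (rule cond_exp_given_rollout[OF ro])
    show "(\<lambda>p. ?F t (fst p) (snd p) ^ 4) \<in> borel_measurable ?P"
      by (intro borel_measurable_power frobenius_norm_measurable jacobian_measurable f \<mu> diff that)
    show "?F t s e ^ 4 = ?F t s e' ^ 4" if "\<And>t. t < T \<Longrightarrow> e t = e' t" for s e e'
      using state_cong[of t e e' f "\<mu> \<theta>" s] that \<open>t < T\<close> by simp
  qed
  have G_eq: "AE \<omega> in M. cond_exp_given M s0
      (\<lambda>\<omega>. (norm (grad_est_mean f \<mu> \<theta> l r \<gamma> T (s0 \<omega>) (\<lambda>t. \<epsilon> t \<omega>)))\<^sup>2) \<omega>
    = (\<integral>\<^sup>+e. ennreal ((norm (grad_est_mean f \<mu> \<theta> l r \<gamma> T (s0 \<omega>) e))\<^sup>2) \<partial>noise_law l T)"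
  proof (rule cond_exp_given_rollout[OF ro])
    show "(\<lambda>p. (norm (grad_est_mean f \<mu> \<theta> l r \<gamma> T (fst p) (snd p)))\<^sup>2) \<in> borel_measurable ?P"
      unfolding grad_est_mean_eq
      using R_meas v_meas
      by (intro borel_measurable_power measurable_compose[OF _ borel_measurable_norm]
          borel_measurable_scaleR borel_measurable_sum) auto
    show "(norm (grad_est_mean f \<mu> \<theta> l r \<gamma> T s e))\<^sup>2 = (norm (grad_est_mean f \<mu> \<theta> l r \<gamma> T s e'))\<^sup>2"
      if e: "\<And>t. t < T \<Longrightarrow> e t = e' t" for s e e'
    proof -
      have "(\<Sum>t<T. score_mean f \<mu> \<theta> l t s e) = (\<Sum>t<T. score_mean f \<mu> \<theta> l t s e')"
        by (intro sum.cong refl score_mean_cong e) auto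
      then show ?thesis
        using total_return_cong[of T e e' f "\<mu> \<theta>" r \<gamma> s] e by (simp add: grad_est_mean_eq)
    qed
  qed
  \<comment> \<open>Only finitely many times occur, so one null set serves them all.\<close>
  have "AE \<omega> in M. \<forall>t\<in>{..<T}. J t \<omega> < \<infinity> \<and> J t \<omega> = (\<integral>\<^sup>+e. ennreal (?F t (s0 \<omega>) e ^ 4) \<partial>noise_law l T)"
    using J J_eq by (intro AE_finite_allI) auto
  then show ?thesis
    using cond_exp_return4[OF f \<mu> r ro, of \<theta> \<gamma>, folded R_def] R G_eq
  proof eventually_elim
    case (elim \<omega>)
    let ?b = "\<lambda>t. enn2real (J t \<omega>) * (?S ^ 4 * ?K)"
    have v: "(\<integral>\<^sup>+e. ennreal (norm (score_mean f \<mu> \<theta> l t (s0 \<omega>) e) ^ 4) \<partial>noise_law l T) \<le> ennreal (?b t)"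
      if "t < T" for t
    proof -
      \<comment> \<open>Finiteness is essential for passing to reals: \<open>enn2real\<close> would
        send infinity to 0.\<close>
      have "J t \<omega> < top"
        using elim(1) that unfolding infinity_ennreal_def by blast
      then have "J t \<omega> = ennreal (enn2real (J t \<omega>))"
        by simp
      then have "J t \<omega> * ennreal (?S ^ 4 * ?K) = ennreal (?b t)"
        using K by (metis ennreal_mult' enn2real_nonneg)
      moreover have "J t \<omega> = (\<integral>\<^sup>+e. ennreal (?F t (s0 \<omega>) e ^ 4) \<partial>noise_law l T)"
        using elim(1) that by blast
      ultimately show ?thesis
        using nn_integral_score_mean4_le[OF f \<mu> diff that, where s = "s0 \<omega>" and l = l] by simp
    qed
    have "(\<integral>\<^sup>+e. ennreal ((norm (grad_est_mean f \<mu> \<theta> l r \<gamma> T (s0 \<omega>) e))\<^sup>2) \<partial>noise_law l T)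
      \<le> ennreal (real T * sqrt (enn2real (R \<omega>)) * (\<Sum>t<T. sqrt (?b t)))"
      unfolding grad_est_mean_eq elim(2)
      using elim K v
      by (intro nn_integral_norm_scaleR_sum_sq_le noise_law_section_measurable R_meas v_meas) auto
    \<comment> \<open>Taking the root of the fourth-moment bound turns the fourth power of the
      spectral norm into the square that appears in (i).\<close>
    also have "(\<Sum>t<T. sqrt (?b t)) = ?S\<^sup>2 * sqrt ?K * (\<Sum>t<T. sqrt (enn2real (J t \<omega>)))"
    proof -
      have "sqrt (?S ^ 4) = ?S\<^sup>2"
        by (rule real_sqrt_unique) (auto simp: power_mult[symmetric])
      then have "sqrt (?b t) = ?S\<^sup>2 * sqrt ?K * sqrt (enn2real (J t \<omega>))" for t
        by (simp only: real_sqrt_mult mult.commute mult.left_commute)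
      then show ?thesis
        by (simp add: sum_distrib_left)
    qed
    finally show ?case
      using elim by (simp only: mult.assoc mult.commute mult.left_commute)
  qed
qed

text \<open>The scores at different times have the same law, so their T fourth-moment bounds
  coincide. Summing them contributes a second factor T next to the one from the squared norm of a
  sum.\<close>

lemma cond_exp_grad_est_logstd_le:
  fixes f :: "(real^'n) \<times> (real^'m) \<Rightarrow> real^'n" and \<mu> :: "real^'p \<Rightarrow> real^'n \<Rightarrow> real^'m"
    and \<gamma> :: real
  assumes f: "f \<in> borel_measurable borel" and \<mu>: "\<mu> \<theta> \<in> borel_measurable borel"
    and r: "r \<in> borel_measurable borel" and ro: "rollout_space M \<rho> l T s0 \<epsilon>"
  defines "R \<equiv> cond_exp_given M s0 (\<lambda>\<omega>. total_return f (\<mu> \<theta>) r \<gamma> T (s0 \<omega>) (\<lambda>t. \<epsilon> t \<omega>) ^ 4)"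
  assumes R: "AE \<omega> in M. R \<omega> < \<infinity>"
  shows "AE \<omega> in M. cond_exp_given M s0
      (\<lambda>\<omega>. (norm (grad_est_logstd f \<mu> \<theta> l r \<gamma> T (s0 \<omega>) (\<lambda>t. \<epsilon> t \<omega>)))\<^sup>2) \<omega>
    \<le> ennreal ((real T)\<^sup>2 * sqrt (enn2real (\<integral>\<^sup>+x. ennreal (norm (score_logstd l x) ^ 4) \<partial>gaussian_noise l))
        * sqrt (enn2real (R \<omega>)))"
proof -
  let ?P = "borel \<Otimes>\<^sub>M PiM {..<T} (\<lambda>_. borel) :: ((real^'n) \<times> (nat \<Rightarrow> real^'m)) measure"
  let ?K = "\<integral>\<^sup>+x. ennreal (norm (score_logstd l x) ^ 4) \<partial>gaussian_noise l"
  note R_meas = total_return_measurable[OF f \<mu> r, of \<gamma> T]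
  have v_meas: "(\<lambda>p. score_logstd l (snd p t)) \<in> borel_measurable ?P" if "t < T" for t
    using that by simp
  have K: "?K = ennreal (enn2real ?K)"
    using nn_integral_gaussian_noise_score4_finite[of l] by (simp add: score_logstd_def)
  have G_eq: "AE \<omega> in M. cond_exp_given M s0
      (\<lambda>\<omega>. (norm (grad_est_logstd f \<mu> \<theta> l r \<gamma> T (s0 \<omega>) (\<lambda>t. \<epsilon> t \<omega>)))\<^sup>2) \<omega>
    = (\<integral>\<^sup>+e. ennreal ((norm (grad_est_logstd f \<mu> \<theta> l r \<gamma> T (s0 \<omega>) e))\<^sup>2) \<partial>noise_law l T)"
  proof (rule cond_exp_given_rollout[OF ro])
    show "(\<lambda>p. (norm (grad_est_logstd f \<mu> \<theta> l r \<gamma> T (fst p) (snd p)))\<^sup>2) \<in> borel_measurable ?P"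
      unfolding grad_est_logstd_eq
      using R_meas v_meas
      by (intro borel_measurable_power measurable_compose[OF _ borel_measurable_norm]
          borel_measurable_scaleR borel_measurable_sum) auto
    show "(norm (grad_est_logstd f \<mu> \<theta> l r \<gamma> T s e))\<^sup>2 = (norm (grad_est_logstd f \<mu> \<theta> l r \<gamma> T s e'))\<^sup>2"
      if "\<And>t. t < T \<Longrightarrow> e t = e' t" for s e e'
      using total_return_cong[of T e e' f "\<mu> \<theta>" r \<gamma> s] that by (simp add: grad_est_logstd_eq)
  qed
  show ?thesis
    using cond_exp_return4[OF f \<mu> r ro, of \<gamma>, folded R_def] R G_eq
  proof eventually_elim
    case (elim \<omega>)
    have v: "(\<integral>\<^sup>+e. ennreal (norm (score_logstd l (e t)) ^ 4) \<partial>noise_law l T) \<le> ennreal (enn2real ?K)"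
      if "t < T" for t
      using nn_integral_noise_law_component[OF that, of "\<lambda>x. ennreal (norm (score_logstd l x) ^ 4)" l] K
      by simp
    have "(\<integral>\<^sup>+e. ennreal ((norm (grad_est_logstd f \<mu> \<theta> l r \<gamma> T (s0 \<omega>) e))\<^sup>2) \<partial>noise_law l T)
      \<le> ennreal (real T * sqrt (enn2real (R \<omega>)) * (\<Sum>t<T. sqrt (enn2real ?K)))"
      unfolding grad_est_logstd_eq elim(1)
    proof (intro nn_integral_norm_scaleR_sum_sq_le v)
      show "(\<lambda>e. score_logstd l (e t)) \<in> borel_measurable (noise_law l T)" if "t < T" for t
        using that by simp
    qed (use elim in \<open>auto intro: noise_law_section_measurable R_meas\<close>)
    then show ?case
      using elim by (simp add: power2_eq_square mult_ac)
  qed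
qed

theorem theorem11:
  fixes f :: "(real^'n) \<times> (real^'m) \<Rightarrow> real^'n"
    and \<mu> :: "real^'p \<Rightarrow> real^'n \<Rightarrow> real^'m"
    and \<theta> :: "real^'p"
    and l :: "real^'m"
    and T :: nat
  assumes "f \<in> borel_measurable borel"
    and "\<And>\<eta>. \<mu> \<eta> \<in> borel_measurable borel"
    and "\<And>\<eta> s. (\<lambda>\<eta>'. \<mu> \<eta>' s) differentiable (at \<eta>)"
  shows "\<exists>C::real. C \<ge> 0 \<and>
    (\<forall>(r :: (real^'n) \<times> (real^'m) \<Rightarrow> real) (\<gamma>::real) (M :: 'w measure) \<rho> s0 \<epsilon>.
      let E = cond_exp_given M s0;
          noise = (\<lambda>\<omega> t. \<epsilon> t \<omega>);
          R = (\<lambda>\<omega>. total_return f (\<mu> \<theta>) r \<gamma> T (s0 \<omega>) (noise \<omega>));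
          J = (\<lambda>t \<omega>. policy_jacobian \<mu> \<theta> (state f (\<mu> \<theta>) (s0 \<omega>) (noise \<omega>) t));
          G\<^sub>\<theta> = (\<lambda>\<omega>. grad_est_mean f \<mu> \<theta> l r \<gamma> T (s0 \<omega>) (noise \<omega>));
          G\<^sub>l = (\<lambda>\<omega>. grad_est_logstd f \<mu> \<theta> l r \<gamma> T (s0 \<omega>) (noise \<omega>));
          \<Sigma> = noise_cov l
      in
        r \<in> borel_measurable borel \<longrightarrow>
        rollout_space M \<rho> l T s0 \<epsilon> \<longrightarrow>
        (AE \<omega> in M. E (\<lambda>\<omega>. R \<omega> ^ 4) \<omega> < \<infinity>) \<longrightarrow>
        (\<forall>t<T. AE \<omega> in M. E (\<lambda>\<omega>. frobenius_norm (J t \<omega>) ^ 4) \<omega> < \<infinity>) \<longrightarrow>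
        (AE \<omega> in M. E (\<lambda>\<omega>. (norm (G\<^sub>\<theta> \<omega>))\<^sup>2) \<omega> \<le>
           ennreal (real T * (spectral_norm (matrix_inv \<Sigma>))\<^sup>2
             * sqrt (enn2real (E (\<lambda>\<omega>. R \<omega> ^ 4) \<omega>))
             * sqrt ((trace \<Sigma>)\<^sup>2 + 2 * trace (\<Sigma> ** \<Sigma>))
             * (\<Sum>t<T. sqrt (enn2real (E (\<lambda>\<omega>. frobenius_norm (J t \<omega>) ^ 4) \<omega>))))) \<and>
        (AE \<omega> in M. E (\<lambda>\<omega>. (norm (G\<^sub>l \<omega>))\<^sup>2) \<omega> \<le>
           ennreal (C * sqrt (enn2real (E (\<lambda>\<omega>. R \<omega> ^ 4) \<omega>)))))"
proof (intro exI conjI)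
  \<comment> \<open>This witness involves only T and l, so it is fixed before the reward, the
    discount, the probability space and the initial state. The fourth moment in it is finite by
    \<open>nn_integral_gaussian_noise_score4_finite\<close>, so \<open>enn2real\<close> preserves
    it.\<close>
  let ?C = "(real T)\<^sup>2 * sqrt (enn2real (\<integral>\<^sup>+x. ennreal (norm (score_logstd l x) ^ 4) \<partial>gaussian_noise l))"
  show "0 \<le> ?C"
    by simp
qed (unfold Let_def, intro allI impI conjI cond_exp_grad_est_mean_le cond_exp_grad_est_logstd_le assms; blast)

end
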